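(* The abstract nonsingular curve associated to $\mathbb{Q}_{max}(T)$ over $\mathbb{Q}_{max}$, constructed by using strict valuations, is homeomorphic to the subspace of the projective line $\mathbb{P}^1_{\mathbb{F}_1}$ over $\mathbb{F}_1$ consisting of all closed points.
   Context: Semirings are commutative, with $0\ne1$ and absorbing zero. $\mathbb{Q}_{max}$ is the semifield with underlying set $\mathbb{Q}\cup\{-\infty\}$, addition $\max$ and multiplication usual addition ($-\infty$ absorbing); its zero is $-\infty$ and its multiplicative identity is the number $0$. $\mathbb{Q}_{max}[T]$ is the polynomial semiring over $\mathbb{Q}_{max}$; $f=\sum a_iT^i$ is evaluated at $t\in\mathbb{Q}_{max}$ by $f(t)=\max_i\{a_i+it\}$, with $f(-\infty)=a_0$. Functional equivalence $f\sim g$ means $f(t)=g(t)$ for all $t\in\mathbb{Q}_{max}$; it is a congruence. $\mathbb{Q}_{max}(T)$ is the localization of $\mathbb{Q}_{max}[T]/\sim$ at its set of nonzero elements. A strict valuation on a semiring $S$ is a function $\nu:S\to\mathbb{R}\cup\{-\infty\}$ with $\nu(0_S)=-\infty$, $\nu(xy)=\nu(x)+\nu(y)$, $\nu(x+y)=\max\{\nu(x),\nu(y)\}$ for all $x,y\in S$, and $\nu(S)\ne\{-\infty\}$. It is discrete if $\nu(S\setminus\{0_S\})\simeq\mathbb{Z}$. Two strict valuations are equivalent if $\nu_1=\rho\,\nu_2$ for some real $\rho>0$ (with $\rho\cdot(-\infty)=-\infty$). A valuation on $\mathbb{Q}_{max}(T)$ is trivial on $\mathbb{Q}_{max}$ if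 $\nu(q)=0$ for all constants $q\in\mathbb{Q}$. The abstract (nonsingular) curve associated to $\mathbb{Q}_{max}(T)$ over $\mathbb{Q}_{max}$ constructed by using strict valuations is the topological space whose underlying set is the set of equivalence classes of discrete strict valuations on $\mathbb{Q}_{max}(T)$ which are trivial on $\mathbb{Q}_{max}$, endowed with the discrete topology. Projective line over $\mathbb{F}_1$: for a commutative monoid $M$ with absorbing element $0_M$, an ideal is a subset $I\subseteq M$ containing $0_M$ with $IM\subseteq I$; a prime ideal is a proper ideal $P$ such that $xy\in P$ implies $x\in P$ or $y\in P$. $\mathrm{Spec}\,M$ is the set of prime ideals with the Zariski topology (closed sets $\{P\mid I\subseteq P\}$ for ideals $I$). Let $C_\infty=\{t^n\mid n\in\mathbb{Z}\}\cup\{0\}$, $C_{\infty,+}=\{t^n\mid n\ge0\}\cup\{0\}$ and $C_{\infty,-}=\{t^{-n}\mid n\geq0\}\cup\{0\}$. As a topological space, $\mathbb{P}^1_{\mathbb{F}_1}$ is obtained by gluing $U_+=\mathrm{Spec}\,C_{\infty,+}$ and $U_-=\mathrm{Spec}\,C_{\infty,-}$ along $U=\mathrm{Spec}\,C_\infty$, which is the one-point space $\{\{0\}\}$ mapped to $U_\pm$ as the open point $\{0\}$. *)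

theory Defs
  imports
    "HOL-Analysis.Sum_Topology"
    "HOL-Library.Extended_Real"
    "HOL-Computational_Algebra.Polynomial"
    "HOL-Algebra.Elementary_Groups"
begin

section \<open>The semifield of tropical rationals\<close>

datatype qmax = MInf | Fin rat

instantiation qmax :: comm_semiring_1
begin

definition zero_qmax :: qmax where "0 = MInf"

definition one_qmax :: qmax where "1 = Fin 0"

fun plus_qmax :: "qmax \<Rightarrow> qmax \<Rightarrow> qmax" where
  "MInf + y = y"
| "Fin a + MInf = Fin a"
| "Fin a + Fin b = Fin (max a b)"

fun times_qmax :: "qmax \<Rightarrow> qmax \<Rightarrow> qmax" where
  "MInf * y = MInf"
| "Fin a * MInf = MInf"
| "Fin a * Fin b = Fin (a + b)"

instance
proof
  fix a b c :: qmax
  show "a + b + c = a + (b + c)" by (cases a; cases b; cases c) (auto simp: max.assoc)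
  show "a + b = b + a" by (cases a; cases b) (auto simp: max.commute)
  show "0 + a = a" by (simp add: zero_qmax_def)
  show "a * b * c = a * (b * c)" by (cases a; cases b; cases c) auto
  show "a * b = b * a" by (cases a; cases b) auto
  show "1 * a = a" by (cases a) (auto simp: one_qmax_def)
  show "(a + b) * c = a * c + b * c" by (cases a; cases b; cases c) (auto simp: max_add_distrib_left)
  show "0 * a = 0" by (simp add: zero_qmax_def)
  show "a * 0 = 0" by (cases a) (auto simp: zero_qmax_def)
  show "(0::qmax) \<noteq> 1" by (simp add: zero_qmax_def one_qmax_def)
qed

end

lemma qmax_add_eq_0_iff: "a + b = 0 \<longleftrightarrow> a = 0 \<and> b = 0" for a b :: qmax
  by (cases a; cases b) (auto simp: zero_qmax_def)

lemma qmax_mult_eq_0_iff: "a * b = 0 \<longleftrightarrow> a = 0 \<or> b = 0" for a b :: qmax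
  by (cases a; cases b) (auto simp: zero_qmax_def)


section \<open>Polynomials modulo functional equivalence\<close>

text \<open>Over \<^typ>\<open>qmax\<close>, the library evaluation \<^const>\<open>poly\<close> is the maximum of the
  numbers \<open>a\<^sub>i + i t\<close>, and \<open>poly f MInf\<close> is the constant coefficient.\<close>

definition fun_equiv :: "qmax poly \<Rightarrow> qmax poly \<Rightarrow> bool" where
  "fun_equiv f g \<longleftrightarrow> (\<forall>t. poly f t = poly g t)"

quotient_type qmax_polyfun = "qmax poly" / fun_equiv
  morphisms rep_polyfun polyfun
  by (rule equivpI) (auto simp: fun_equiv_def reflp_def symp_def transp_def)

lemma poly_qmax_eq_0_iff: "poly f (Fin r) = 0 \<longleftrightarrow> f = 0" for f :: "qmax poly"
proof (induction f)
  case (pCons a f)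
  have "Fin r \<noteq> 0" by (simp add: zero_qmax_def)
  then show ?case using pCons by (simp add: qmax_add_eq_0_iff qmax_mult_eq_0_iff)
qed simp

lemma fun_equiv_0_iff: "fun_equiv f 0 \<longleftrightarrow> f = 0"
  by (metis fun_equiv_def poly_0 poly_qmax_eq_0_iff)

instantiation qmax_polyfun :: "{comm_semiring_1, semiring_no_zero_divisors}"
begin

lift_definition zero_qmax_polyfun :: qmax_polyfun is 0 .

lift_definition one_qmax_polyfun :: qmax_polyfun is 1 .

lift_definition plus_qmax_polyfun :: "qmax_polyfun \<Rightarrow> qmax_polyfun \<Rightarrow> qmax_polyfun" is "(+)"
  by (simp add: fun_equiv_def)

lift_definition times_qmax_polyfun :: "qmax_polyfun \<Rightarrow> qmax_polyfun \<Rightarrow> qmax_polyfun" is "(*)"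
  by (simp add: fun_equiv_def)

instance
proof
  fix a b c :: qmax_polyfun
  show "a + b + c = a + (b + c)" by transfer (simp add: fun_equiv_def add.assoc)
  show "a + b = b + a" by transfer (simp add: fun_equiv_def add.commute)
  show "0 + a = a" by transfer (simp add: fun_equiv_def)
  show "a * b * c = a * (b * c)" by transfer (simp add: fun_equiv_def mult.assoc)
  show "a * b = b * a" by transfer (simp add: fun_equiv_def mult.commute)
  show "1 * a = a" by transfer (simp add: fun_equiv_def)
  show "(a + b) * c = a * c + b * c" by transfer (simp add: fun_equiv_def distrib_right)
  show "a * (b + c) = a * b + a * c" by transfer (simp add: fun_equiv_def distrib_left)
  show "0 * a = 0" by transfer (simp add: fun_equiv_def)
  show "a * 0 = 0" by transfer (simp add: fun_equiv_def)
  show "(0::qmax_polyfun) \<noteq> 1" by transfer (simp add: fun_equiv_def)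
  show "a * b \<noteq> 0" if "a \<noteq> 0" "b \<noteq> 0"
    using that
  proof transfer
    fix f g :: "qmax poly"
    assume "\<not> fun_equiv f 0" "\<not> fun_equiv g 0"
    then have "poly f (Fin 0) \<noteq> 0" "poly g (Fin 0) \<noteq> 0"
      by (simp_all add: fun_equiv_0_iff poly_qmax_eq_0_iff)
    then have "poly (f * g) (Fin 0) \<noteq> 0"
      by (simp add: qmax_mult_eq_0_iff)
    then show "\<not> fun_equiv (f * g) 0"
      by (metis fun_equiv_def poly_0)
  qed
qed

end


section \<open>Localization at the nonzero elements\<close>

text \<open>The extra factor \<open>u\<close> is needed because semirings without zero divisors need not be
  multiplicatively cancellative.\<close>

definition loc_rel ::
  "'a::{comm_semiring_1, semiring_no_zero_divisors} \<times> 'a \<Rightarrow> 'a \<times> 'a \<Rightarrow> bool" where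
  "loc_rel x y \<longleftrightarrow> snd x \<noteq> 0 \<and> snd y \<noteq> 0 \<and>
     (\<exists>u. u \<noteq> 0 \<and> u * (fst x * snd y) = u * (fst y * snd x))"

lemma loc_rel_trans:
  assumes "loc_rel x y" "loc_rel y z"
  shows "loc_rel x z"
proof -
  obtain a s b t c r where [simp]: "x = (a, s)" "y = (b, t)" "z = (c, r)"
    by (cases x; cases y; cases z)
  obtain u v where nz: "s \<noteq> 0" "t \<noteq> 0" "r \<noteq> 0" "u \<noteq> 0" "v \<noteq> 0"
    and u: "u * (a * t) = u * (b * s)" and v: "v * (b * r) = v * (c * t)"
    using assms by (auto simp: loc_rel_def)
  have "(u * v * t) * (a * r) = (v * r) * (u * (a * t))" by (simp add: ac_simps)
  also have "\<dots> = (u * s) * (v * (b * r))" unfolding u by (simp add: ac_simps)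
  also have "\<dots> = (u * v * t) * (c * s)" unfolding v by (simp add: ac_simps)
  finally show ?thesis
    using nz by (auto simp: loc_rel_def intro!: exI[of _ "u * v * t"])
qed

quotient_type (overloaded) 'a localization =
  "'a::{comm_semiring_1, semiring_no_zero_divisors} \<times> 'a" / partial: loc_rel
proof (rule part_equivpI)
  show "\<exists>x::'a \<times> 'a. loc_rel x x"
    by (rule exI[of _ "(0, 1)"]) (auto simp: loc_rel_def intro: exI[of _ 1])
  show "symp (loc_rel :: 'a \<times> 'a \<Rightarrow> _)"
    unfolding symp_def loc_rel_def by metis
  show "transp (loc_rel :: 'a \<times> 'a \<Rightarrow> _)"
    by (rule transpI) (rule loc_rel_trans)
qed

lemma loc_relI:
  "s \<noteq> 0 \<Longrightarrow> t \<noteq> 0 \<Longrightarrow> a * t = b * s \<Longrightarrow> loc_rel (a, s) (b, t)"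
  by (auto simp: loc_rel_def intro!: exI[of _ 1])

instantiation localization :: ("{comm_semiring_1, semiring_no_zero_divisors}") comm_semiring_1
begin

lift_definition zero_localization :: "'a localization" is "(0, 1)"
  by (rule loc_relI) auto

lift_definition one_localization :: "'a localization" is "(1, 1)"
  by (rule loc_relI) auto

lift_definition plus_localization :: "'a localization \<Rightarrow> 'a localization \<Rightarrow> 'a localization"
  is "\<lambda>(a, s) (b, t). (a * t + b * s, s * t)"
proof clarify
  fix a s a' s' b t b' t' :: 'a
  assume 1: "loc_rel (a, s) (a', s')" and 2: "loc_rel (b, t) (b', t')"
  obtain u v where nz: "s \<noteq> 0" "s' \<noteq> 0" "t \<noteq> 0" "t' \<noteq> 0" "u \<noteq> 0" "v \<noteq> 0"
    and u: "u * (a * s') = u * (a' * s)" and v: "v * (b * t') = v * (b' * t)"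
    using 1 2 by (auto simp: loc_rel_def)
  have "(u * v) * ((a * t + b * s) * (s' * t'))
      = (v * t * t') * (u * (a * s')) + (u * s * s') * (v * (b * t'))"
    by (simp add: algebra_simps)
  also have "\<dots> = (u * v) * ((a' * t' + b' * s') * (s * t))"
    unfolding u v by (simp add: algebra_simps)
  finally show "loc_rel (a * t + b * s, s * t) (a' * t' + b' * s', s' * t')"
    using nz by (auto simp: loc_rel_def intro!: exI[of _ "u * v"])
qed

lift_definition times_localization :: "'a localization \<Rightarrow> 'a localization \<Rightarrow> 'a localization"
  is "\<lambda>(a, s) (b, t). (a * b, s * t)"
proof clarify
  fix a s a' s' b t b' t' :: 'a
  assume 1: "loc_rel (a, s) (a', s')" and 2: "loc_rel (b, t) (b', t')"
  obtain u v where nz: "s \<noteq> 0" "s' \<noteq> 0" "t \<noteq> 0" "t' \<noteq> 0" "u \<noteq> 0" "v \<noteq> 0"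
    and u: "u * (a * s') = u * (a' * s)" and v: "v * (b * t') = v * (b' * t)"
    using 1 2 by (auto simp: loc_rel_def)
  have "(u * v) * (a * b * (s' * t')) = (u * (a * s')) * (v * (b * t'))"
    by (simp add: ac_simps)
  also have "\<dots> = (u * v) * (a' * b' * (s * t))"
    unfolding u v by (simp add: ac_simps)
  finally show "loc_rel (a * b, s * t) (a' * b', s' * t')"
    using nz by (auto simp: loc_rel_def intro!: exI[of _ "u * v"])
qed

instance
proof
  fix a b c :: "'a localization"
  have snd: "snd x \<noteq> 0" if "loc_rel x x" for x :: "'a \<times> 'a"
    using that by (simp add: loc_rel_def)
  show "a + b + c = a + (b + c)"
    by transfer (auto dest!: snd intro!: loc_relI simp: algebra_simps)
  show "a + b = b + a" by transfer (auto dest!: snd intro!: loc_relI simp: algebra_simps)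
  show "0 + a = a" by transfer (auto dest!: snd intro!: loc_relI simp: algebra_simps)
  show "a * b * c = a * (b * c)"
    by transfer (auto dest!: snd intro!: loc_relI simp: algebra_simps)
  show "a * b = b * a" by transfer (auto dest!: snd intro!: loc_relI simp: algebra_simps)
  show "1 * a = a" by transfer (auto dest!: snd intro!: loc_relI simp: algebra_simps)
  show "(a + b) * c = a * c + b * c"
    by transfer (auto dest!: snd intro!: loc_relI simp: algebra_simps)
  show "0 * a = 0" by transfer (auto dest!: snd intro!: loc_relI simp: algebra_simps)
  show "a * 0 = 0" by transfer (auto dest!: snd intro!: loc_relI simp: algebra_simps)
  show "(0::'a localization) \<noteq> 1" by transfer (simp add: loc_rel_def)
qed

end

lift_definition loc_of :: "'a::{comm_semiring_1, semiring_no_zero_divisors} \<Rightarrow> 'a localization"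
  is "\<lambda>a. (a, 1)"
  by (rule loc_relI) auto

type_synonym qmax_ratfun = "qmax_polyfun localization"

definition qmax_const :: "qmax \<Rightarrow> qmax_ratfun" where
  "qmax_const q = loc_of (polyfun [:q:])"


section \<open>Strict valuations\<close>

text \<open>The target \<open>\<real> \<union> {-\<infinity>}\<close> is the set of extended reals other than \<open>\<infinity>\<close>.\<close>

definition strict_valuation :: "('a::comm_semiring_1 \<Rightarrow> ereal) \<Rightarrow> bool" where
  "strict_valuation \<nu> \<longleftrightarrow>
     (\<forall>x. \<nu> x \<noteq> \<infinity>) \<and>
     \<nu> 0 = -\<infinity> \<and>
     (\<forall>x y. \<nu> (x * y) = \<nu> x + \<nu> y) \<and>
     (\<forall>x y. \<nu> (x + y) = max (\<nu> x) (\<nu> y)) \<and>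
     range \<nu> \<noteq> {-\<infinity>}"

definition value_monoid :: "('a::comm_semiring_1 \<Rightarrow> ereal) \<Rightarrow> ereal monoid" where
  "value_monoid \<nu> = \<lparr>carrier = \<nu> ` (UNIV - {0}), monoid.mult = (+), one = 0\<rparr>"

definition discrete_valuation :: "('a::comm_semiring_1 \<Rightarrow> ereal) \<Rightarrow> bool" where
  "discrete_valuation \<nu> \<longleftrightarrow> value_monoid \<nu> \<cong> integer_group"

definition equivalent_valuations :: "('a \<Rightarrow> ereal) \<Rightarrow> ('a \<Rightarrow> ereal) \<Rightarrow> bool" where
  "equivalent_valuations \<nu>\<^sub>1 \<nu>\<^sub>2 \<longleftrightarrow> (\<exists>\<rho>::real. \<rho> > 0 \<and> (\<forall>x. \<nu>\<^sub>1 x = ereal \<rho> * \<nu>\<^sub>2 x))"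

definition trivial_on_qmax :: "(qmax_ratfun \<Rightarrow> ereal) \<Rightarrow> bool" where
  "trivial_on_qmax \<nu> \<longleftrightarrow> (\<forall>q::rat. \<nu> (qmax_const (Fin q)) = 0)"

definition curve_valuations :: "(qmax_ratfun \<Rightarrow> ereal) set" where
  "curve_valuations = {\<nu>. strict_valuation \<nu> \<and> discrete_valuation \<nu> \<and> trivial_on_qmax \<nu>}"

definition abstract_curve :: "(qmax_ratfun \<Rightarrow> ereal) set topology" where
  "abstract_curve = discrete_topology
     (curve_valuations //
       {(\<nu>\<^sub>1, \<nu>\<^sub>2) \<in> curve_valuations \<times> curve_valuations. equivalent_valuations \<nu>\<^sub>1 \<nu>\<^sub>2})"


section \<open>Spectra of commutative monoids with zero\<close>

text \<open>A monoid with zero is a submonoid \<open>M\<close>, containing \<open>0\<close>, of an ambient type.\<close>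

definition monoid_ideal :: "'a::{comm_monoid_mult, mult_zero} set \<Rightarrow> 'a set \<Rightarrow> bool" where
  "monoid_ideal M I \<longleftrightarrow> I \<subseteq> M \<and> 0 \<in> I \<and> (\<forall>x\<in>I. \<forall>y\<in>M. x * y \<in> I)"

definition monoid_prime :: "'a::{comm_monoid_mult, mult_zero} set \<Rightarrow> 'a set \<Rightarrow> bool" where
  "monoid_prime M P \<longleftrightarrow>
     monoid_ideal M P \<and> P \<noteq> M \<and> (\<forall>x\<in>M. \<forall>y\<in>M. x * y \<in> P \<longrightarrow> x \<in> P \<or> y \<in> P)"

definition monoid_spec :: "'a::{comm_monoid_mult, mult_zero} set \<Rightarrow> 'a set set" where
  "monoid_spec M = {P. monoid_prime M P}"

definition zariski :: "'a::{comm_monoid_mult, mult_zero} set \<Rightarrow> 'a set topology" where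
  "zariski M = topology
     (\<lambda>U. \<exists>I. monoid_ideal M I \<and> U = monoid_spec M - {P \<in> monoid_spec M. I \<subseteq> P})"

lemma istopology_zariski:
  fixes M :: "'a::{comm_monoid_mult, mult_zero} set"
  assumes "0 \<in> M"
  shows "istopology
     (\<lambda>U. \<exists>I. monoid_ideal M I \<and> U = monoid_spec M - {P \<in> monoid_spec M. I \<subseteq> P})"
  unfolding istopology_def
proof (intro conjI allI impI)
  fix S T
  assume "\<exists>I. monoid_ideal M I \<and> S = monoid_spec M - {P \<in> monoid_spec M. I \<subseteq> P}"
    and "\<exists>I. monoid_ideal M I \<and> T = monoid_spec M - {P \<in> monoid_spec M. I \<subseteq> P}"
  then obtain I J where I: "monoid_ideal M I" "S = monoid_spec M - {P \<in> monoid_spec M. I \<subseteq> P}"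
    and J: "monoid_ideal M J" "T = monoid_spec M - {P \<in> monoid_spec M. J \<subseteq> P}"
    by blast
  have "I \<subseteq> P \<or> J \<subseteq> P" if P: "P \<in> monoid_spec M" and sub: "I \<inter> J \<subseteq> P" for P
  proof (rule ccontr)
    assume "\<not> (I \<subseteq> P \<or> J \<subseteq> P)"
    then obtain x y where xy: "x \<in> I" "x \<notin> P" "y \<in> J" "y \<notin> P" by blast
    then have M: "x \<in> M" "y \<in> M" using I(1) J(1) by (auto simp: monoid_ideal_def)
    have "x * y \<in> I" "y * x \<in> J" using I(1) J(1) xy M by (auto simp: monoid_ideal_def)
    then have "x * y \<in> P" using sub by (auto simp: mult.commute)
    then show False using P xy M by (auto simp: monoid_spec_def monoid_prime_def)
  qed
  then have "S \<inter> T = monoid_spec M - {P \<in> monoid_spec M. I \<inter> J \<subseteq> P}"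
    using I J by blast
  moreover have "monoid_ideal M (I \<inter> J)"
    using I J by (auto simp: monoid_ideal_def)
  ultimately show "\<exists>K. monoid_ideal M K \<and>
      S \<inter> T = monoid_spec M - {P \<in> monoid_spec M. K \<subseteq> P}" by blast
next
  fix \<K>
  assume "\<forall>S\<in>\<K>. \<exists>I. monoid_ideal M I \<and> S = monoid_spec M - {P \<in> monoid_spec M. I \<subseteq> P}"
  then obtain f where f: "\<And>S. S \<in> \<K> \<Longrightarrow> monoid_ideal M (f S)"
    "\<And>S. S \<in> \<K> \<Longrightarrow> S = monoid_spec M - {P \<in> monoid_spec M. f S \<subseteq> P}" by metis
  let ?I = "insert 0 (\<Union>S\<in>\<K>. f S)"
  have "monoid_ideal M ?I"
    using f(1) assms by (fastforce simp: monoid_ideal_def)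
  moreover have "\<Union>\<K> = monoid_spec M - {P \<in> monoid_spec M. ?I \<subseteq> P}"
  proof -
    have "0 \<in> P" if "P \<in> monoid_spec M" for P
      using that by (simp add: monoid_spec_def monoid_prime_def monoid_ideal_def)
    moreover have "\<Union>\<K> = (\<Union>S\<in>\<K>. monoid_spec M - {P \<in> monoid_spec M. f S \<subseteq> P})"
      using f(2) by auto
    ultimately show ?thesis by auto
  qed
  ultimately show "\<exists>K. monoid_ideal M K \<and>
      \<Union>\<K> = monoid_spec M - {P \<in> monoid_spec M. K \<subseteq> P}" by blast
qed

lemma openin_zariski:
  assumes "0 \<in> M"
  shows "openin (zariski M) U \<longleftrightarrow>
    (\<exists>I. monoid_ideal M I \<and> U = monoid_spec M - {P \<in> monoid_spec M. I \<subseteq> P})"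
  using topology_inverse'[OF istopology_zariski[OF assms]] by (simp add: zariski_def)

section \<open>Quotient spaces and gluing\<close>

definition quotient_space :: "'a topology \<Rightarrow> ('a \<times> 'a) set \<Rightarrow> 'a set topology" where
  "quotient_space X r = topology
     (\<lambda>U. U \<subseteq> topspace X // r \<and> openin X {x \<in> topspace X. r `` {x} \<in> U})"

lemma istopology_quotient_space:
  "istopology (\<lambda>U. U \<subseteq> topspace X // r \<and> openin X {x \<in> topspace X. r `` {x} \<in> U})"
proof -
  have 1: "{x \<in> topspace X. r `` {x} \<in> S \<inter> T} =
      {x \<in> topspace X. r `` {x} \<in> S} \<inter> {x \<in> topspace X. r `` {x} \<in> T}" for S T
    by auto
  have 2: "{x \<in> topspace X. r `` {x} \<in> \<Union>\<K>} =
      (\<Union>K\<in>\<K>. {x \<in> topspace X. r `` {x} \<in> K})" for \<K>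
    by auto
  show ?thesis
    unfolding istopology_def 1 2 by blast
qed

lemma openin_quotient_space:
  "openin (quotient_space X r) U \<longleftrightarrow>
     U \<subseteq> topspace X // r \<and> openin X {x \<in> topspace X. r `` {x} \<in> U}"
  by (simp add: quotient_space_def topology_inverse'[OF istopology_quotient_space])

text \<open>The disjoint union of \<open>X\<close> (tag \<^const>\<open>True\<close>) and \<open>Y\<close> (tag \<^const>\<open>False\<close>), modulo the
  equivalence relation generated by \<open>i p \<sim> j p\<close> for \<open>p \<in> Z\<close>.\<close>

definition glued_space ::
  "'a topology \<Rightarrow> 'a topology \<Rightarrow> 'z set \<Rightarrow> ('z \<Rightarrow> 'a) \<Rightarrow> ('z \<Rightarrow> 'a) \<Rightarrow> (bool \<times> 'a) set topology" where
  "glued_space X Y Z i j =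
     (let R = {((True, i p), (False, j p)) | p. p \<in> Z}
      in quotient_space (sum_topology (\<lambda>b. if b then X else Y) UNIV) ((R \<union> R\<inverse>)\<^sup>*))"


section \<open>The projective line over the field with one element\<close>

text \<open>\<open>TPow n\<close> stands for \<open>t\<^sup>n\<close>; the type is the whole monoid \<open>C\<^sub>\<infinity>\<close>.\<close>

datatype c_inf = CZero | TPow int

instantiation c_inf :: "{comm_monoid_mult, mult_zero}"
begin

definition zero_c_inf :: c_inf where "0 = CZero"

definition one_c_inf :: c_inf where "1 = TPow 0"

fun times_c_inf :: "c_inf \<Rightarrow> c_inf \<Rightarrow> c_inf" where
  "CZero * y = CZero"
| "TPow m * CZero = CZero"
| "TPow m * TPow n = TPow (m + n)"

instance
proof
  fix a b c :: c_inf
  show "a * b * c = a * (b * c)" by (cases a; cases b; cases c) auto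
  show "a * b = b * a" by (cases a; cases b) auto
  show "1 * a = a" by (cases a) (auto simp: one_c_inf_def)
  show "0 * a = 0" by (simp add: zero_c_inf_def)
  show "a * 0 = 0" by (cases a) (auto simp: zero_c_inf_def)
qed

end

definition C_inf :: "c_inf set" where
  "C_inf = {TPow n | n. True} \<union> {0}"

definition C_inf_plus :: "c_inf set" where
  "C_inf_plus = {TPow n | n. n \<ge> 0} \<union> {0}"

definition C_inf_minus :: "c_inf set" where
  "C_inf_minus = {TPow (- n) | n. n \<ge> 0} \<union> {0}"

text \<open>The maps \<open>Spec C\<^sub>\<infinity> \<rightarrow> Spec C\<^sub>\<plusminus>\<close> induced by the inclusions are given by intersection.\<close>

definition P1_F1 :: "(bool \<times> c_inf set) set topology" where
  "P1_F1 = glued_space (zariski C_inf_plus) (zariski C_inf_minus)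
     (monoid_spec C_inf) (\<lambda>P. P \<inter> C_inf_plus) (\<lambda>P. P \<inter> C_inf_minus)"

lemma monoid_spec_C_inf: "monoid_spec C_inf = {{0}}"
proof -
  have C: "C_inf = UNIV"
  proof -
    have "x \<in> C_inf" for x by (cases x) (simp_all add: C_inf_def zero_c_inf_def)
    then show ?thesis by blast
  qed
  have "P = {0}" if P: "monoid_prime UNIV P" for P :: "c_inf set"
  proof (rule ccontr)
    assume "P \<noteq> {0}"
    moreover have "0 \<in> P" using P by (simp add: monoid_prime_def monoid_ideal_def)
    ultimately obtain y where y: "y \<in> P" "y \<noteq> 0" by blast
    then obtain n where n: "TPow n \<in> P" by (cases y) (simp_all add: zero_c_inf_def)
    have mult: "TPow n * y \<in> P" for y
      using P n by (simp add: monoid_prime_def monoid_ideal_def)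
    have "x \<in> P" for x
      using mult[of "TPow (- n) * x"] by (cases x) simp_all
    then have "P = UNIV" by blast
    then show False using P by (simp add: monoid_prime_def)
  qed
  moreover have "monoid_prime UNIV {0::c_inf}"
  proof -
    have "x * y = 0 \<longleftrightarrow> x = 0 \<or> y = 0" for x y :: c_inf
      by (cases x; cases y) (simp_all add: zero_c_inf_def)
    moreover have "{0} \<noteq> (UNIV :: c_inf set)"
      by (metis UNIV_I c_inf.distinct(1) singletonD)
    ultimately show ?thesis by (simp add: monoid_prime_def monoid_ideal_def)
  qed
  ultimately show ?thesis unfolding monoid_spec_def C by blast
qed

definition closed_points :: "'a topology \<Rightarrow> 'a set" where
  "closed_points X = {x \<in> topspace X. closedin X {x}}"

end

theory Submission
  imports Defs "HOL-Analysis.Extended_Real_Limits" "HOL-Analysis.T1_Spaces"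
begin

text \<open>A strict valuation \<open>\<nu>\<close> trivial on constants maps \<open>a\<^sub>i T\<^sup>i\<close> to \<open>i \<nu>(T)\<close>, and since it turns
  sums into maxima, its value on a polynomial, and hence on a fraction, depends only on \<open>\<nu>(T)\<close>.
  Discreteness excludes \<open>\<nu>(T) = 0\<close>, so the sign of \<open>\<nu>(T)\<close> determines the class of \<open>\<nu>\<close>.
  Both signs occur: the asymptotic slope of the function \<open>t \<mapsto> x(t)\<close> as \<open>t\<close> tends
  to \<open>\<plusminus>\<infinity>\<close> is such a valuation, visibly invariant under functional equivalence.
  The projective line has a generic point, which is open and not closed, and two closed points, which
  form a discrete subspace.\<close>

section \<open>The semifield of rational functions\<close>

lemma loc_of_0: "loc_of 0 = 0"
  by transfer (simp add: loc_relI)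

lemma loc_of_1: "loc_of 1 = 1"
  by transfer (simp add: loc_relI)

lemma loc_of_add: "loc_of (a + b) = loc_of a + loc_of b"
  by transfer (simp add: loc_relI)

lemma loc_of_mult: "loc_of (a * b) = loc_of a * loc_of b"
  by transfer (simp add: loc_relI)

lemma loc_of_eq_0_iff: "loc_of a = 0 \<longleftrightarrow> a = 0"
  by transfer (auto simp: loc_rel_def intro!: exI[of _ 1])

text \<open>Any representing pair provides its numerator as \<open>a\<close> and its denominator as
  \<open>b\<close>. The product form lets multiplicativity of a valuation act on it
  directly.\<close>

lemma localization_fraction:
  obtains a b where "b \<noteq> 0" "x * loc_of b = loc_of a"
proof -
  have "\<exists>a b. b \<noteq> 0 \<and> x * loc_of b = loc_of a"
  proof transfer
    fix x :: "'a \<times> 'a"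
    assume "loc_rel x x"
    then show "\<exists>a b. b \<noteq> 0 \<and> 
        loc_rel ((case x of (p, s) \<Rightarrow> \<lambda>(q, t). (p * q, s * t)) (b, 1)) (a, 1)"
      by (intro exI[of _ "fst x"] exI[of _ "snd x"])
        (auto simp: loc_rel_def mult.commute split: prod.splits intro!: exI[of _ 1])
  qed
  then show ?thesis using that by blast
qed

text \<open>The inverse of a fraction swaps numerator and denominator. This is a legitimate pair
  because a fraction with numerator zero is zero.\<close>

lemma localization_inverse:
  fixes x :: "'a::{comm_semiring_1, semiring_no_zero_divisors} localization"
  assumes "x \<noteq> 0"
  obtains y where "x * y = 1"
proof -
  have "\<exists>y. x * y = 1"
    using assms
  proof transfer
    fix x :: "'a \<times> 'a"
    assume x: "loc_rel x x" "\<not> loc_rel x (0, 1)"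
    obtain a s where [simp]: "x = (a, s)" by (cases x)
    have "s \<noteq> 0" "a \<noteq> 0"
      using x by (auto simp: loc_rel_def)
    then have "loc_rel (s, a) (s, a)" "loc_rel (a * s, s * a) (1, 1)"
      by (auto intro!: loc_relI simp: mult.commute)
    then show "\<exists>y\<in>{x. loc_rel x x}.
        loc_rel ((case x of (a, s) \<Rightarrow> \<lambda>(b, t). (a * b, s * t)) y) (1, 1)"
      by auto
  qed
  then show ?thesis using that by blast
qed

section \<open>The variable T and Horner decomposition of polynomials\<close>

definition ratfun_X :: qmax_ratfun where
  "ratfun_X = loc_of (polyfun [:0, 1:])"

lemma polyfun_0: "polyfun 0 = 0"
  by (simp add: zero_qmax_polyfun.abs_eq)

lemma qmax_const_0: "qmax_const 0 = 0"
  by (simp add: qmax_const_def polyfun_0 loc_of_0)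

lemma qmax_const_1: "qmax_const 1 = 1"
proof -
  have "polyfun [:1:] = 1" by (simp add: one_qmax_polyfun.abs_eq one_pCons)
  then show ?thesis by (simp add: qmax_const_def loc_of_1)
qed

text \<open>Horner's scheme inside the semifield. With it, every induction over polynomials needs
  only the values on constants and on T.\<close>

lemma polyfun_pCons:
  "loc_of (polyfun (pCons a f)) = qmax_const a + ratfun_X * loc_of (polyfun f)"
proof -
  have "pCons a f = [:a:] + [:0, 1:] * f" by simp
  then have "polyfun (pCons a f) = polyfun [:a:] + polyfun [:0, 1:] * polyfun f"
    by (simp add: plus_qmax_polyfun.abs_eq times_qmax_polyfun.abs_eq)
  then show ?thesis
    by (simp add: qmax_const_def ratfun_X_def loc_of_add loc_of_mult)
qed

lemma ratfun_X_nonzero: "ratfun_X \<noteq> 0"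
proof -
  have "polyfun [:0, 1:] \<noteq> 0"
    by (simp add: zero_qmax_polyfun.abs_eq qmax_polyfun.abs_eq_iff fun_equiv_0_iff)
  then show ?thesis by (simp add: ratfun_X_def loc_of_eq_0_iff)
qed


section \<open>Strict valuations trivial on constants\<close>

locale const_trivial_valuation =
  fixes \<nu> :: "qmax_ratfun \<Rightarrow> ereal"
  assumes strict: "strict_valuation \<nu>" and trivial: "trivial_on_qmax \<nu>"
begin

lemma zero: "\<nu> 0 = -\<infinity>" and mult: "\<nu> (x * y) = \<nu> x + \<nu> y"
  and add: "\<nu> (x + y) = max (\<nu> x) (\<nu> y)" and ne_PInf: "\<nu> x \<noteq> \<infinity>"
  using strict by (simp_all add: strict_valuation_def)

lemma const: "\<nu> (qmax_const a) = (if a = 0 then -\<infinity> else 0)"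
  using trivial zero
  by (cases a) (simp_all add: trivial_on_qmax_def qmax_const_0[unfolded zero_qmax_def] zero_qmax_def)

lemma one: "\<nu> 1 = 0"
  using const[of 1] by (simp add: qmax_const_1)

text \<open>The values of \<open>x\<close> and its inverse sum to 0 and neither is \<infinity>, so
  neither can be \<open>-\<infinity>\<close>.\<close>

lemma finite: "\<bar>\<nu> x\<bar> \<noteq> \<infinity>" if nonzero: "x \<noteq> 0"
proof -
  obtain y where "x * y = 1" using localization_inverse[OF nonzero] .
  then have "\<nu> x + \<nu> y = 0" using mult[of x y] by (simp add: one)
  then show ?thesis using ne_PInf[of x] ne_PInf[of y] by (cases "\<nu> x"; cases "\<nu> y") auto
qed

lemma fraction:
  assumes "b \<noteq> 0" "x * loc_of b = loc_of a"
  shows "\<nu> x = \<nu> (loc_of a) - \<nu> (loc_of b)"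
proof -
  have "\<nu> (loc_of a) = \<nu> x + \<nu> (loc_of b)" by (simp add: mult flip: assms(2))
  moreover have "\<bar>\<nu> (loc_of b)\<bar> \<noteq> \<infinity>" using assms(1) by (simp add: finite loc_of_eq_0_iff)
  ultimately show ?thesis by (cases "\<nu> x"; cases "\<nu> (loc_of b)") auto
qed

end

lemma ereal_mult_max_distrib:
  "0 \<le> r \<Longrightarrow> ereal r * max a b = max (ereal r * a) (ereal r * b)"
  by (simp add: ereal_mult_left_mono max_def dual_order.antisym)

text \<open>By Horner's scheme the value on a polynomial arises from the value on T and the constant
  values 0 and \<open>-\<infinity>\<close> by sums and maxima, all compatible with scaling by a
  positive real. Fractions follow by subtraction.\<close>

lemma valuation_determined_by_X:
  assumes "const_trivial_valuation \<mu>" "const_trivial_valuation \<nu>"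
    and \<rho>: "\<rho> > 0" and X: "\<mu> ratfun_X = ereal \<rho> * \<nu> ratfun_X"
  shows "\<mu> x = ereal \<rho> * \<nu> x"
proof -
  interpret \<mu>: const_trivial_valuation \<mu> by fact
  interpret \<nu>: const_trivial_valuation \<nu> by fact
  have poly: "\<mu> (loc_of (polyfun f)) = ereal \<rho> * \<nu> (loc_of (polyfun f))" for f
  proof (induction f)
    case 0
    then show ?case using \<rho> by (simp add: polyfun_0 loc_of_0 \<mu>.zero \<nu>.zero)
  next
    case (pCons a f)
    have "\<mu> (qmax_const a) = ereal \<rho> * \<nu> (qmax_const a)"
      using \<rho> by (simp add: \<mu>.const \<nu>.const)
    \<comment> \<open>Distributivity holds since neither summand is \<infinity>, so no sum of
      opposite infinities can occur.\<close>
    moreover have "ereal \<rho> * (\<nu> ratfun_X + \<nu> y) = ereal \<rho> * \<nu> ratfun_X + ereal \<rho> * \<nu> y" for y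
      using \<nu>.ne_PInf by (intro ereal_distrib_left) auto
    ultimately show ?case
      using \<rho> pCons.IH
      by (simp add: polyfun_pCons \<mu>.add \<nu>.add \<mu>.mult \<nu>.mult ereal_mult_max_distrib X)
  qed
  obtain a b where ab: "b \<noteq> 0" "x * loc_of b = loc_of a" by (rule localization_fraction)
  obtain f g where fg: "a = polyfun f" "b = polyfun g" by (metis Quotient_abs_rep Quotient_qmax_polyfun)
  have "\<bar>\<nu> (loc_of b)\<bar> \<noteq> \<infinity>" using ab by (simp add: \<nu>.finite loc_of_eq_0_iff)
  then have "ereal \<rho> * (\<nu> (loc_of a) - \<nu> (loc_of b)) = ereal \<rho> * \<nu> (loc_of a) - ereal \<rho> * \<nu> (loc_of b)"
    using \<nu>.ne_PInf by (intro ereal_distrib_minus_left) auto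
  then show ?thesis
    using poly \<mu>.fraction[OF ab] \<nu>.fraction[OF ab] by (simp add: fg)
qed

text \<open>If T had value 0, Horner's scheme would yield only 0 and \<open>-\<infinity>\<close> on
  polynomials. All nonzero fractions would then have value 0, leaving too few values for a bijection
  with the integers.\<close>

lemma discrete_valuation_X_nonzero:
  assumes "const_trivial_valuation \<nu>" "discrete_valuation \<nu>"
  shows "\<nu> ratfun_X \<noteq> 0"
proof
  interpret const_trivial_valuation \<nu> by fact
  assume X: "\<nu> ratfun_X = 0"
  have poly: "\<nu> (loc_of (polyfun f)) \<in> {0, -\<infinity>}" for f
    by (induction f) (auto simp: polyfun_0 loc_of_0 zero polyfun_pCons add mult const X max_def)
  have val: "\<nu> x = 0" if "x \<noteq> 0" for x
  proof -
    obtain a b where ab: "b \<noteq> 0" "x * loc_of b = loc_of a" by (rule localization_fraction)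
    obtain f g where fg: "a = polyfun f" "b = polyfun g" by (metis Quotient_abs_rep Quotient_qmax_polyfun)
    have "\<bar>\<nu> (loc_of b)\<bar> \<noteq> \<infinity>" using ab by (simp add: finite loc_of_eq_0_iff)
    then have "\<nu> (loc_of b) = 0" using poly[of g] fg by auto
    moreover have "\<nu> (loc_of a) \<in> {0, -\<infinity>}" using poly fg by blast
    ultimately have "\<nu> x \<in> {0, -\<infinity>}" using fraction[OF ab] by simp
    then show ?thesis using finite[OF that] by auto
  qed
  obtain h where "bij_betw h (carrier (value_monoid \<nu>)) (UNIV :: int set)"
    using assms(2) by (auto simp: discrete_valuation_def is_iso_def iso_def)
  then have "infinite (carrier (value_monoid \<nu>))"
    by (simp add: bij_betw_finite infinite_UNIV_int)
  moreover have "carrier (value_monoid \<nu>) \<subseteq> {0}"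
    using val by (auto simp: value_monoid_def)
  ultimately show False by (meson finite.emptyI finite.insertI finite_subset)
qed


section \<open>Asymptotic slopes\<close>

text \<open>A function value divided by the distance \<open>Suc n\<close>, which is positive also
  for \<open>n = 0\<close>. As a positive multiple of the embedding of \<open>qmax\<close>, it
  respects products and maxima; on constants it becomes trivial only in the limit.\<close>

fun slope :: "nat \<Rightarrow> qmax \<Rightarrow> ereal" where
  "slope n MInf = -\<infinity>"
| "slope n (Fin q) = ereal (of_rat q / real (Suc n))"

lemma slope_mult: "slope n (a * b) = slope n a + slope n b"
  by (cases a; cases b) (auto simp: of_rat_add add_divide_distrib)

lemma slope_add: "slope n (a + b) = max (slope n a) (slope n b)"
  by (cases a; cases b) (auto simp: max_def of_rat_less_eq divide_le_cancel simp del: of_nat_Suc)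

lemma slope_0: "slope n 0 = -\<infinity>"
  by (simp add: zero_qmax_def)

lemma slope_1: "slope n 1 = 0"
  by (simp add: one_qmax_def zero_ereal_def)

lemma slope_ne_PInf: "slope n a \<noteq> \<infinity>"
  by (cases a) auto

lemma slope_finite: "a \<noteq> 0 \<Longrightarrow> \<bar>slope n a\<bar> \<noteq> \<infinity>"
  by (cases a) (auto simp: zero_qmax_def)

text \<open>Evaluation points that run to \<infinity> for \<open>c > 0\<close> and to
  \<open>-\<infinity>\<close> for \<open>c < 0\<close>, scaled so that T has slope exactly
  \<open>c\<close> at every \<open>n\<close>.\<close>

definition ray :: "int \<Rightarrow> nat \<Rightarrow> qmax" where
  "ray c n = Fin (of_int c * of_nat (Suc n))"

lemma slope_ray: "slope n (ray c n) = ereal (of_int c)"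
  by (simp add: ray_def of_rat_mult del: of_nat_Suc)

lemma slope_const_tendsto: "(\<lambda>n. slope n (Fin q)) \<longlonglongrightarrow> 0"
  unfolding slope.simps zero_ereal_def
  by (intro tendsto_ereal LIMSEQ_Suc[OF lim_const_over_n])

text \<open>In Horner's scheme, multiplication by T shifts the limit by \<open>c\<close>, and a
  nonzero constant coefficient replaces it by its maximum with 0. Both operations keep it an
  integer, which later gives discreteness.\<close>

lemma slope_poly_tendsto:
  "f \<noteq> 0 \<Longrightarrow> \<exists>k::int. (\<lambda>n. slope n (poly f (ray c n))) \<longlonglongrightarrow> ereal (of_int k)"
proof (induction f)
  case (pCons a f)
  show ?case
  proof (cases "f = 0")
    case True
    then obtain q where "a = Fin q" using pCons by (cases a) (auto simp: zero_qmax_def)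
    then show ?thesis
      using True slope_const_tendsto[of q]
      by (intro exI[of _ 0]) (simp add: zero_ereal_def)
  next
    case False
    then obtain k :: int where k: "(\<lambda>n. slope n (poly f (ray c n))) \<longlonglongrightarrow> ereal (of_int k)"
      using pCons by blast
    have "(\<lambda>n. ereal (of_int c) + slope n (poly f (ray c n))) \<longlonglongrightarrow> ereal (of_int c) + ereal (of_int k)"
      by (intro tendsto_add_ereal k tendsto_const) auto
    then have s: "(\<lambda>n. ereal (of_int c) + slope n (poly f (ray c n))) \<longlonglongrightarrow> ereal (of_int (c + k))"
      by simp
    show ?thesis
    proof (cases a)
      case MInf
      then show ?thesis using s
        by (intro exI[of _ "c + k"]) (simp add: slope_add slope_mult slope_ray)
    next
      case (Fin q)
      have "(\<lambda>n. max (slope n a) (ereal (of_int c) + slope n (poly f (ray c n))))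
          \<longlonglongrightarrow> max 0 (ereal (of_int (c + k)))"
        unfolding Fin by (intro tendsto_max slope_const_tendsto s)
      moreover have "max 0 (ereal (of_int (c + k))) = ereal (of_int (max 0 (c + k)))"
        by (simp add: zero_ereal_def max_def)
      ultimately show ?thesis
        by (intro exI[of _ "max 0 (c + k)"]) (simp add: slope_add slope_mult slope_ray)
    qed
  qed
qed simp

section \<open>Slopes of rational functions along a ray\<close>

lift_definition polyfun_eval :: "qmax \<Rightarrow> qmax_polyfun \<Rightarrow> qmax" is "\<lambda>t f. poly f t"
  by (simp add: fun_equiv_def)

lemma polyfun_eval_0: "polyfun_eval t 0 = 0"
  and polyfun_eval_1: "polyfun_eval t 1 = 1"
  and polyfun_eval_add: "polyfun_eval t (a + b) = polyfun_eval t a + polyfun_eval t b"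
  and polyfun_eval_mult: "polyfun_eval t (a * b) = polyfun_eval t a * polyfun_eval t b"
  by (transfer; simp)+

text \<open>Points of a ray are finite, and maxima admit no cancellation there. Hence denominators
  always have finite slope.\<close>

lemma polyfun_eval_ray_eq_0_iff: "polyfun_eval (ray c n) a = 0 \<longleftrightarrow> a = 0"
  unfolding ray_def by transfer (simp add: poly_qmax_eq_0_iff fun_equiv_0_iff)

text \<open>A quotient becomes a difference of slopes. For each fixed \<open>n\<close> this already
  respects products and maxima, and these laws then pass to the limit.\<close>

lift_definition ratfun_slope :: "int \<Rightarrow> nat \<Rightarrow> qmax_ratfun \<Rightarrow> ereal" is
  "\<lambda>c n (a, s). slope n (polyfun_eval (ray c n) a) - slope n (polyfun_eval (ray c n) s)"
proof clarify
  fix c :: int and n and a s b t :: qmax_polyfun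
  let ?S = "\<lambda>p. slope n (polyfun_eval (ray c n) p)"
  assume "loc_rel (a, s) (b, t)"
  then obtain u where nz: "s \<noteq> 0" "t \<noteq> 0" "u \<noteq> 0" and u: "u * (a * t) = u * (b * s)"
    by (auto simp: loc_rel_def)
  have "?S (u * (a * t)) = ?S (u * (b * s))" unfolding u ..
  then have "?S u + (?S a + ?S t) = ?S u + (?S b + ?S s)"
    by (simp add: polyfun_eval_mult slope_mult)
  \<comment> \<open>Only the numerators can have slope \<open>-\<infinity>\<close>; the finite
    slopes of \<open>u\<close>, \<open>s\<close> and \<open>t\<close> cancel from the
    cross-multiplied equation.\<close>
  moreover have "\<bar>?S u\<bar> \<noteq> \<infinity>" "\<bar>?S s\<bar> \<noteq> \<infinity>" "\<bar>?S t\<bar> \<noteq> \<infinity>"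
    using nz by (simp_all add: slope_finite polyfun_eval_ray_eq_0_iff)
  ultimately show "?S a - ?S s = ?S b - ?S t"
    using slope_ne_PInf[of n "polyfun_eval (ray c n) a"] slope_ne_PInf[of n "polyfun_eval (ray c n) b"]
    by (cases "?S a"; cases "?S b"; cases "?S u"; cases "?S s"; cases "?S t") auto
qed

lemma ratfun_slope_loc_of: "ratfun_slope c n (loc_of a) = slope n (polyfun_eval (ray c n) a)"
  by transfer (simp add: polyfun_eval_1 slope_1)

lemma ratfun_slope_mult: "ratfun_slope c n (x * y) = ratfun_slope c n x + ratfun_slope c n y"
proof transfer
  fix c :: int and n :: nat and x y :: "qmax_polyfun \<times> qmax_polyfun"
  let ?S = "\<lambda>p. slope n (polyfun_eval (ray c n) p)"
  assume "loc_rel x x" "loc_rel y y"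
  moreover obtain a s b t where [simp]: "x = (a, s)" "y = (b, t)" by (cases x; cases y)
  ultimately have "s \<noteq> 0" "t \<noteq> 0" by (auto simp: loc_rel_def)
  then have "\<bar>?S s\<bar> \<noteq> \<infinity>" "\<bar>?S t\<bar> \<noteq> \<infinity>"
    by (simp_all add: slope_finite polyfun_eval_ray_eq_0_iff)
  then have "?S (a * b) - ?S (s * t) = ?S a - ?S s + (?S b - ?S t)"
    using slope_ne_PInf[of n "polyfun_eval (ray c n) a"] slope_ne_PInf[of n "polyfun_eval (ray c n) b"]
    unfolding polyfun_eval_mult slope_mult
    by (cases "?S a"; cases "?S b"; cases "?S s"; cases "?S t") auto
  then show "(case (case x of (a, s) \<Rightarrow> \<lambda>(b, t). (a * b, s * t)) y of (a, s) \<Rightarrow> ?S a - ?S s)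
    = (case x of (a, s) \<Rightarrow> ?S a - ?S s) + (case y of (a, s) \<Rightarrow> ?S a - ?S s)"
    by simp
qed

lemma ratfun_slope_add: "ratfun_slope c n (x + y) = max (ratfun_slope c n x) (ratfun_slope c n y)"
proof transfer
  fix c :: int and n :: nat and x y :: "qmax_polyfun \<times> qmax_polyfun"
  let ?S = "\<lambda>p. slope n (polyfun_eval (ray c n) p)"
  assume "loc_rel x x" "loc_rel y y"
  moreover obtain a s b t where [simp]: "x = (a, s)" "y = (b, t)" by (cases x; cases y)
  ultimately have "s \<noteq> 0" "t \<noteq> 0" by (auto simp: loc_rel_def)
  then have "\<bar>?S s\<bar> \<noteq> \<infinity>" "\<bar>?S t\<bar> \<noteq> \<infinity>"
    by (simp_all add: slope_finite polyfun_eval_ray_eq_0_iff)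
  \<comment> \<open>Over the common denominator, subtracting finite slopes commutes with taking the
    maximum.\<close>
  then have "?S (a * t + b * s) - ?S (s * t) = max (?S a - ?S s) (?S b - ?S t)"
    using slope_ne_PInf[of n "polyfun_eval (ray c n) a"] slope_ne_PInf[of n "polyfun_eval (ray c n) b"]
    unfolding polyfun_eval_mult polyfun_eval_add slope_mult slope_add
    by (cases "?S a"; cases "?S b"; cases "?S s"; cases "?S t") (auto simp: max_def)
  then show "(case (case x of (a, s) \<Rightarrow> \<lambda>(b, t). (a * t + b * s, s * t)) y of
      (a, s) \<Rightarrow> ?S a - ?S s)
    = max (case x of (a, s) \<Rightarrow> ?S a - ?S s) (case y of (a, s) \<Rightarrow> ?S a - ?S s)"
    by simp
qed

lemma ratfun_slope_0: "ratfun_slope c n 0 = -\<infinity>"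
  using ratfun_slope_loc_of[of c n 0] by (simp add: loc_of_0 polyfun_eval_0 slope_0)

lemma ratfun_slope_const: "ratfun_slope c n (qmax_const q) = slope n q"
  by (simp add: qmax_const_def ratfun_slope_loc_of polyfun_eval.abs_eq)

lemma ratfun_slope_X: "ratfun_slope c n ratfun_X = ereal (of_int c)"
  by (simp add: ratfun_X_def ratfun_slope_loc_of polyfun_eval.abs_eq slope_ray)

text \<open>Numerator and denominator of a nonzero fraction are both nonzero, so their slopes have
  integer limits, and these can be subtracted.\<close>

lemma ratfun_slope_tendsto:
  assumes "x \<noteq> 0"
  shows "\<exists>k::int. (\<lambda>n. ratfun_slope c n x) \<longlonglongrightarrow> ereal (of_int k)"
proof -
  obtain a b where ab: "b \<noteq> 0" "x * loc_of b = loc_of a" by (rule localization_fraction)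
  have a: "a \<noteq> 0"
  proof
    assume "a = 0"
    then have *: "x * loc_of b = 0" using ab by (simp add: loc_of_0)
    \<comment> \<open>Both factors are units, so their product cannot vanish.\<close>
    obtain y z where yz: "x * y = 1" "loc_of b * z = 1"
      using assms ab localization_inverse by (metis loc_of_eq_0_iff)
    have "1 = (x * loc_of b) * (y * z)"
      using yz by (metis (no_types) mult.assoc mult.commute mult.left_commute mult.right_neutral)
    then show False using * by simp
  qed
  have poly: "\<exists>k::int. (\<lambda>n. ratfun_slope c n (loc_of p)) \<longlonglongrightarrow> ereal (of_int k)" if p: "p \<noteq> 0" for p
  proof -
    obtain f where f: "p = polyfun f" by (metis Quotient_abs_rep Quotient_qmax_polyfun)
    then have "f \<noteq> 0" using p polyfun_0 by blast
    then show ?thesis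
      using slope_poly_tendsto by (simp add: f ratfun_slope_loc_of polyfun_eval.abs_eq)
  qed
  obtain k l :: int where k: "(\<lambda>n. ratfun_slope c n (loc_of a)) \<longlonglongrightarrow> ereal (of_int k)"
    and l: "(\<lambda>n. ratfun_slope c n (loc_of b)) \<longlonglongrightarrow> ereal (of_int l)"
    using poly a ab by metis
  have "(\<lambda>n. ratfun_slope c n (loc_of a) - ratfun_slope c n (loc_of b))
      \<longlonglongrightarrow> ereal (of_int k) - ereal (of_int l)"
    unfolding minus_ereal_def
    by (intro tendsto_add_ereal k tendsto_uminus_ereal l) auto
  moreover have "ratfun_slope c n (loc_of a) - ratfun_slope c n (loc_of b) = ratfun_slope c n x" for n
  proof -
    have "\<bar>ratfun_slope c n (loc_of b)\<bar> \<noteq> \<infinity>"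
      using ab(1) by (simp add: ratfun_slope_loc_of slope_finite polyfun_eval_ray_eq_0_iff)
    moreover have "ratfun_slope c n (loc_of a) = ratfun_slope c n x + ratfun_slope c n (loc_of b)"
      by (simp add: ratfun_slope_mult flip: ab(2))
    ultimately show ?thesis
      by (cases "ratfun_slope c n x"; cases "ratfun_slope c n (loc_of b)") auto
  qed
  ultimately show ?thesis by (auto intro!: exI[of _ "k - l"])
qed


section \<open>The curve has exactly two points\<close>

text \<open>\<open>slope_val 1\<close> is the degree, \<open>slope_val (-1)\<close> is minus the order of vanishing at \<open>MInf\<close>.\<close>

definition slope_val :: "int \<Rightarrow> qmax_ratfun \<Rightarrow> ereal" where
  "slope_val c x = lim (\<lambda>n. ratfun_slope c n x)"

lemma slope_val_eqI: "(\<lambda>n. ratfun_slope c n x) \<longlonglongrightarrow> L \<Longrightarrow> slope_val c x = L"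
  by (simp add: slope_val_def limI)

lemma slope_val_0: "slope_val c 0 = -\<infinity>"
  by (rule slope_val_eqI) (simp add: ratfun_slope_0)

lemma slope_val_int: "x \<noteq> 0 \<Longrightarrow> \<exists>k::int. slope_val c x = ereal (of_int k)"
  using ratfun_slope_tendsto slope_val_eqI by blast

lemma slope_val_ne_PInf: "slope_val c x \<noteq> \<infinity>"
  using slope_val_int[of x c] slope_val_0[of c] by (cases "x = 0") auto

text \<open>The sequence converges for every \<open>x\<close>: it is constantly
  \<open>-\<infinity>\<close> at zero and has an integer limit elsewhere. So \<open>lim\<close>
  never falls back on an arbitrary value.\<close>

lemma slope_val_tendsto: "(\<lambda>n. ratfun_slope c n x) \<longlonglongrightarrow> slope_val c x"
proof (cases "x = 0")
  case True
  then show ?thesis by (simp add: slope_val_0 ratfun_slope_0)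
next
  case False
  then show ?thesis using ratfun_slope_tendsto slope_val_eqI by metis
qed

lemma slope_val_X: "slope_val c ratfun_X = ereal (of_int c)"
  by (rule slope_val_eqI) (simp add: ratfun_slope_X)

text \<open>The laws hold at each \<open>n\<close> and pass to the limit; for sums this uses that no
  limit is \<infinity>. Constants have slopes tending to 0.\<close>

lemma const_trivial_slope_val: "const_trivial_valuation (slope_val c)"
proof
  have "slope_val c (x * y) = slope_val c x + slope_val c y" for x y
    by (rule slope_val_eqI, unfold ratfun_slope_mult,
        intro tendsto_add_ereal_general slope_val_tendsto)
      (auto simp: slope_val_ne_PInf)
  moreover have "slope_val c (x + y) = max (slope_val c x) (slope_val c y)" for x y
    by (rule slope_val_eqI, unfold ratfun_slope_add, intro tendsto_max slope_val_tendsto)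
  \<comment> \<open>T attains the finite value \<open>c\<close>.\<close>
  moreover have "range (slope_val c) \<noteq> {-\<infinity>}"
    using slope_val_X[of c] by (metis MInfty_neq_ereal(1) rangeI singletonD)
  ultimately show "strict_valuation (slope_val c)"
    by (simp add: strict_valuation_def slope_val_ne_PInf slope_val_0)
  show "trivial_on_qmax (slope_val c)"
    by (auto simp: trivial_on_qmax_def ratfun_slope_const slope_const_tendsto
        simp del: slope.simps intro!: slope_val_eqI)
qed

lemma slope_val_surj:
  assumes "c = 1 \<or> c = -1"
  shows "\<exists>x. x \<noteq> 0 \<and> slope_val c x = ereal (of_int k)"
proof -
  interpret const_trivial_valuation "slope_val c" by (rule const_trivial_slope_val)
  obtain Y where Y: "ratfun_X * Y = 1" using localization_inverse[OF ratfun_X_nonzero] .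
  have "ereal (of_int c) + slope_val c Y = 0"
    using mult[of ratfun_X Y] by (simp add: Y one slope_val_X)
  then have vY: "slope_val c Y = ereal (of_int (- c))"
    by (cases "slope_val c Y") (auto simp: zero_ereal_def)
  have pow: "slope_val c (x ^ m) = ereal (of_int (int m * j))"
    if "slope_val c x = ereal (of_int j)" for x m j
    using that by (induction m) (auto simp: one mult zero_ereal_def algebra_simps)
  \<comment> \<open>As \<open>c * c = 1\<close>, the integer \<open>k\<close> equals
    \<open>(k * c) * c\<close>. The witness is thus a power of T or of its inverse \<open>Y\<close>,
    according to the sign of \<open>k * c\<close>.\<close>
  have "\<exists>x. slope_val c x = ereal (of_int k)"
  proof (cases "k * c \<ge> 0")
    case True
    then have "int (nat (k * c)) * c = k" using assms by auto
    then show ?thesis using pow[OF slope_val_X, of "nat (k * c)"] by metis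
  next
    case False
    then have "int (nat (- (k * c))) * - c = k" using assms by auto
    then show ?thesis using pow[OF vY, of "nat (- (k * c))"] by metis
  qed
  then show ?thesis using slope_val_0 by (metis MInfty_neq_ereal(1))
qed

lemma discrete_slope_val:
  assumes "c = 1 \<or> c = -1"
  shows "discrete_valuation (slope_val c)"
proof -
  have carrier: "carrier (value_monoid (slope_val c)) = range (\<lambda>k::int. ereal (of_int k))"
  proof
    show "carrier (value_monoid (slope_val c)) \<subseteq> range (\<lambda>k::int. ereal (of_int k))"
      using slope_val_int by (auto simp: value_monoid_def)
    show "range (\<lambda>k::int. ereal (of_int k)) \<subseteq> carrier (value_monoid (slope_val c))"
    proof clarify
      fix k :: int
      obtain x where "x \<noteq> 0" "slope_val c x = ereal (of_int k)"
        using slope_val_surj[OF assms] by blast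
      then show "ereal (of_int k) \<in> carrier (value_monoid (slope_val c))"
        unfolding value_monoid_def partial_object.simps by (metis DiffI UNIV_I image_eqI singletonD)
    qed
  qed
  \<comment> \<open>The floor inverts the embedding of the integers on the carrier computed
    above.\<close>
  have "(\<lambda>e. \<lfloor>real_of_ereal e\<rfloor>) \<in> iso (value_monoid (slope_val c)) integer_group"
  proof (rule isoI)
    show "(\<lambda>e. \<lfloor>real_of_ereal e\<rfloor>) \<in> hom (value_monoid (slope_val c)) integer_group"
      unfolding hom_def carrier by (auto simp: value_monoid_def)
    show "bij_betw (\<lambda>e. \<lfloor>real_of_ereal e\<rfloor>) (carrier (value_monoid (slope_val c))) (carrier integer_group)"
      unfolding carrier by (auto simp: bij_betw_def inj_on_def image_image)
  qed
  then show ?thesis unfolding discrete_valuation_def by (rule is_isoI)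
qed

lemma slope_val_in_curve: "c = 1 \<or> c = -1 \<Longrightarrow> slope_val c \<in> curve_valuations"
  using const_trivial_slope_val[of c] discrete_slope_val[of c]
  by (simp add: curve_valuations_def const_trivial_valuation_def)

text \<open>The value \<open>r\<close> on T is finite and nonzero. Its absolute value is the scaling
  factor, and its sign selects the slope valuation.\<close>

lemma curve_valuation_equiv_slope_val:
  assumes "\<nu> \<in> curve_valuations"
  shows "equivalent_valuations \<nu> (slope_val 1) \<or> equivalent_valuations \<nu> (slope_val (-1))"
proof -
  have ct: "const_trivial_valuation \<nu>" and discrete: "discrete_valuation \<nu>"
    using assms by (auto simp: curve_valuations_def const_trivial_valuation_def)
  interpret const_trivial_valuation \<nu> by fact
  obtain r where r: "\<nu> ratfun_X = ereal r"
    using finite[OF ratfun_X_nonzero] by (cases "\<nu> ratfun_X") auto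
  have "r \<noteq> 0" using discrete_valuation_X_nonzero[OF ct discrete] by (auto simp: r zero_ereal_def)
  then consider "r > 0" | "r < 0" by linarith
  then show ?thesis
  proof cases
    case 1
    have "\<nu> x = ereal r * slope_val 1 x" for x
      using 1 by (rule valuation_determined_by_X[OF ct const_trivial_slope_val]) (simp add: r slope_val_X)
    then show ?thesis using 1 unfolding equivalent_valuations_def by blast
  next
    case 2
    have "\<nu> x = ereal (- r) * slope_val (-1) x" for x
      by (rule valuation_determined_by_X[OF ct const_trivial_slope_val])
        (use 2 in \<open>simp_all add: r slope_val_X\<close>)
    then show ?thesis using 2 unfolding equivalent_valuations_def by (metis neg_0_less_iff_less)
  qed
qed

section \<open>Equivalence classes of valuations\<close>

lemma equivalent_valuations_sym:
  assumes "equivalent_valuations \<mu> \<nu>"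
  shows "equivalent_valuations \<nu> \<mu>"
proof -
  obtain \<rho> :: real where \<rho>: "\<rho> > 0" "\<And>x. \<mu> x = ereal \<rho> * \<nu> x"
    using assms by (auto simp: equivalent_valuations_def)
  have "\<nu> x = ereal (1 / \<rho>) * \<mu> x" for x
    using \<rho> by (cases "\<nu> x") auto
  then show ?thesis
    using \<rho>(1) unfolding equivalent_valuations_def by (intro exI[of _ "1 / \<rho>"]) auto
qed

lemma equivalent_valuations_trans:
  assumes "equivalent_valuations \<kappa> \<mu>" "equivalent_valuations \<mu> \<nu>"
  shows "equivalent_valuations \<kappa> \<nu>"
proof -
  obtain \<rho> \<sigma> :: real where "\<rho> > 0" "\<And>x. \<kappa> x = ereal \<rho> * \<mu> x" "\<sigma> > 0" "\<And>x. \<mu> x = ereal \<sigma> * \<nu> x"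
    using assms by (auto simp: equivalent_valuations_def)
  then show ?thesis
    unfolding equivalent_valuations_def
    by (intro exI[of _ "\<rho> * \<sigma>"]) (auto simp: mult.assoc simp flip: times_ereal.simps(1))
qed

lemma equiv_curve_valuations:
  "equiv curve_valuations
     {(\<nu>\<^sub>1, \<nu>\<^sub>2) \<in> curve_valuations \<times> curve_valuations. equivalent_valuations \<nu>\<^sub>1 \<nu>\<^sub>2}"
proof (rule equivI)
  have "equivalent_valuations \<nu> \<nu>" for \<nu> :: "qmax_ratfun \<Rightarrow> ereal"
    unfolding equivalent_valuations_def
    by (intro exI[of _ 1]) (simp flip: one_ereal_def)
  then show "refl_on curve_valuations
     {(\<nu>\<^sub>1, \<nu>\<^sub>2) \<in> curve_valuations \<times> curve_valuations. equivalent_valuations \<nu>\<^sub>1 \<nu>\<^sub>2}"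
    by (auto simp: refl_on_def)
qed (auto intro!: symI transI intro: equivalent_valuations_sym equivalent_valuations_trans)

lemma abstract_curve_two_points:
  obtains A B where "A \<noteq> B" "abstract_curve = discrete_topology {A, B}"
proof -
  let ?E = "{(\<nu>\<^sub>1, \<nu>\<^sub>2) \<in> curve_valuations \<times> curve_valuations. equivalent_valuations \<nu>\<^sub>1 \<nu>\<^sub>2}"
  let ?A = "?E `` {slope_val 1}" and ?B = "?E `` {slope_val (-1)}"
  have in_curve: "slope_val 1 \<in> curve_valuations" "slope_val (-1) \<in> curve_valuations"
    by (simp_all add: slope_val_in_curve)
  have "\<not> equivalent_valuations (slope_val 1) (slope_val (-1))"
  proof
    assume "equivalent_valuations (slope_val 1) (slope_val (-1))"
    then obtain \<rho> :: real where "\<rho> > 0" "slope_val 1 ratfun_X = ereal \<rho> * slope_val (-1) ratfun_X"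
      by (auto simp: equivalent_valuations_def)
    \<comment> \<open>A positive factor cannot turn the value -1 on T into 1.\<close>
    then show False unfolding slope_val_X by simp
  qed
  then have "?A \<noteq> ?B"
    using eq_equiv_class[OF _ equiv_curve_valuations in_curve(2)] by blast
  moreover have "curve_valuations // ?E = {?A, ?B}"
  proof
    show "curve_valuations // ?E \<subseteq> {?A, ?B}"
    proof
      fix Q assume "Q \<in> curve_valuations // ?E"
      then obtain \<nu> where \<nu>: "\<nu> \<in> curve_valuations" "Q = ?E `` {\<nu>}" by (rule quotientE)
      then have "(\<nu>, slope_val 1) \<in> ?E \<or> (\<nu>, slope_val (-1)) \<in> ?E"
        using curve_valuation_equiv_slope_val in_curve by blast
      then show "Q \<in> {?A, ?B}"
        using equiv_class_eq[OF equiv_curve_valuations] \<nu>(2) by blast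
    qed
    show "{?A, ?B} \<subseteq> curve_valuations // ?E"
      using in_curve by (blast intro: quotientI)
  qed
  ultimately show ?thesis
    using that[of ?A ?B] by (simp add: abstract_curve_def)
qed


section \<open>The closed points of the projective line\<close>

text \<open>A common form of \<open>C_inf_plus\<close> (\<open>e = 1\<close>) and \<open>C_inf_minus\<close> (\<open>e = -1\<close>), with its maximal ideal.\<close>

definition half_monoid :: "int \<Rightarrow> c_inf set" where
  "half_monoid e = {TPow (e * n) | n. n \<ge> 0} \<union> {0}"

definition half_max :: "int \<Rightarrow> c_inf set" where
  "half_max e = {TPow (e * n) | n. n > 0} \<union> {0}"

lemma C_inf_plus_eq: "C_inf_plus = half_monoid 1"
  and C_inf_minus_eq: "C_inf_minus = half_monoid (-1)"
  by (simp_all add: C_inf_plus_def C_inf_minus_def half_monoid_def)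

lemma half_max_ne_0: "half_max e \<noteq> {0}"
proof -
  have "TPow (e * 1) \<in> half_max e" unfolding half_max_def by force
  then show ?thesis by (auto simp: zero_c_inf_def)
qed

text \<open>A nonzero prime ideal contains a positive power of the generator \<open>TPow e\<close>,
  hence by primality the generator itself, hence all of \<open>half_max e\<close>. Conversely, the
  complements of \<open>{0}\<close> and of \<open>half_max e\<close> (the latter consisting only of
  1) are closed under multiplication.\<close>

lemma monoid_spec_half_monoid:
  assumes "e \<noteq> 0"
  shows "monoid_spec (half_monoid e) = {{0}, half_max e}"
proof
  show "monoid_spec (half_monoid e) \<subseteq> {{0}, half_max e}"
  proof clarify
    fix P assume "P \<in> monoid_spec (half_monoid e)" and nonzero: "P \<noteq> {0}"
    then have prime: "monoid_prime (half_monoid e) P" by (simp add: monoid_spec_def)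
    then have ideal: "P \<subseteq> half_monoid e" "0 \<in> P" "\<And>x y. x \<in> P \<Longrightarrow> y \<in> half_monoid e \<Longrightarrow> x * y \<in> P"
      and proper: "P \<noteq> half_monoid e"
      and split: "\<And>x y. x \<in> half_monoid e \<Longrightarrow> y \<in> half_monoid e \<Longrightarrow> x * y \<in> P \<Longrightarrow> x \<in> P \<or> y \<in> P"
      by (auto simp: monoid_prime_def monoid_ideal_def)
    have mem: "TPow (e * n) \<in> half_monoid e" if "n \<ge> 0" for n
      using that by (auto simp: half_monoid_def)
    have one: "TPow 0 \<notin> P"
    proof
      assume "TPow 0 \<in> P"
      then have "half_monoid e \<subseteq> P" using ideal(3)[of "TPow 0"]
        by (metis mult_1 one_c_inf_def subsetI)
      then show False using ideal(1) proper by blast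
    qed
    have sub: "P \<subseteq> half_max e"
    proof
      fix x assume x: "x \<in> P"
      then consider "x = 0" | n where "n \<ge> 0" "x = TPow (e * n)"
        using ideal(1) by (auto simp: half_monoid_def)
      then show "x \<in> half_max e"
      proof cases
        case 2
        then have "n \<noteq> 0" using one x by auto
        then show ?thesis using 2 by (auto simp: half_max_def)
      qed (simp add: half_max_def)
    qed
    \<comment> \<open>Primality splits off one generator at a time; exponent 0 is impossible because
      \<open>P\<close> does not contain 1.\<close>
    have gen: "TPow e \<in> P" if "TPow (e * int m) \<in> P" for m
      using that
    proof (induction m)
      case (Suc m)
      then have "TPow e * TPow (e * int m) \<in> P" by (simp add: algebra_simps)
      then show ?case using split[of "TPow e" "TPow (e * int m)"] mem[of 1] mem[of "int m"] Suc.IH by auto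
    qed (use one in simp)
    obtain n where n: "n > 0" "TPow (e * n) \<in> P"
      using ideal(2) sub nonzero by (auto simp: half_max_def)
    then have e: "TPow e \<in> P" using gen[of "nat n"] by simp
    have "TPow (e * k) \<in> P" if "k > 0" for k
      using ideal(3)[OF e mem[of "k - 1"]] that by (simp add: algebra_simps)
    then have "half_max e \<subseteq> P" using ideal(2) by (auto simp: half_max_def)
    then show "P = half_max e" using sub by blast
  qed
next
  have nz: "TPow n \<noteq> 0" "TPow n * TPow m \<noteq> 0" for n m by (simp_all add: zero_c_inf_def)
  have T0: "TPow 0 \<in> half_monoid e" unfolding half_monoid_def by force
  have prime_0: "monoid_prime (half_monoid e) {0}"
    unfolding monoid_prime_def monoid_ideal_def
  proof (intro conjI ballI impI)
    show "{0} \<noteq> half_monoid e" using T0 nz by (metis singletonD)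
  qed (auto simp: half_monoid_def nz)
  have T0': "TPow 0 \<notin> half_max e" using assms by (auto simp: half_max_def nz)
  have "monoid_prime (half_monoid e) (half_max e)"
    unfolding monoid_prime_def monoid_ideal_def
  proof (intro conjI ballI impI)
    show "half_max e \<subseteq> half_monoid e" by (force simp: half_max_def half_monoid_def)
    show "0 \<in> half_max e" by (simp add: half_max_def)
    show "half_max e \<noteq> half_monoid e" using T0 T0' by blast
  next
    fix x y assume "x \<in> half_max e" "y \<in> half_monoid e"
    then consider "x = 0 \<or> y = 0" | n m where "x = TPow (e * n)" "n > 0" "y = TPow (e * m)" "m \<ge> 0"
      by (auto simp: half_max_def half_monoid_def)
    then show "x * y \<in> half_max e"
    proof cases
      case 2
      then show ?thesis by (auto simp: half_max_def simp flip: distrib_left intro!: exI[of _ "n + m"])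
    qed (auto simp: half_max_def)
  next
    fix x y assume "x \<in> half_monoid e" "y \<in> half_monoid e" and xy: "x * y \<in> half_max e"
    then consider "x = 0 \<or> y = 0" | n m where "x = TPow (e * n)" "n \<ge> 0" "y = TPow (e * m)" "m \<ge> 0"
      by (auto simp: half_monoid_def)
    then show "x \<in> half_max e \<or> y \<in> half_max e"
    proof cases
      case 2
      show ?thesis
      proof (cases "n = 0 \<and> m = 0")
        case True
        then show ?thesis using 2 xy T0' by simp
      next
        case False
        then have "n > 0 \<or> m > 0" using 2 by auto
        then show ?thesis using 2 by (auto simp: half_max_def)
      qed
    qed (auto simp: half_max_def)
  qed
  then show "{{0}, half_max e} \<subseteq> monoid_spec (half_monoid e)"
    using prime_0 by (simp add: monoid_spec_def)
qed

text \<open>Each half is a Sierpinski space with open generic point \<open>{0}\<close> and closed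
  point \<open>half_max e\<close>.\<close>

lemma zariski_half_monoid:
  assumes "e \<noteq> 0"
  shows "topspace (zariski (half_monoid e)) = {{0}, half_max e}"
    and "openin (zariski (half_monoid e)) {{0}}"
    and "\<not> openin (zariski (half_monoid e)) {half_max e}"
proof -
  have 0: "0 \<in> half_monoid e" by (simp add: half_monoid_def)
  note op = openin_zariski[OF 0] and spec = monoid_spec_half_monoid[OF assms]
  have mI: "monoid_ideal (half_monoid e) P" if "P \<in> monoid_spec (half_monoid e)" for P
    using that by (simp add: monoid_spec_def monoid_prime_def)
  have max_0: "0 \<in> half_max e" by (simp add: half_max_def)
  have whole: "monoid_ideal (half_monoid e) (half_monoid e)"
  proof -
    have "x * y \<in> half_monoid e" if "x \<in> half_monoid e" "y \<in> half_monoid e" for x y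
      using that by (fastforce simp: half_monoid_def simp flip: distrib_left)
    then show ?thesis using 0 by (simp add: monoid_ideal_def)
  qed
  \<comment> \<open>The unit ideal cuts out the empty closed set, which makes the whole spectrum
    open.\<close>
  have "\<not> half_monoid e \<subseteq> P" if "P \<in> monoid_spec (half_monoid e)" for P
    using that by (auto simp: monoid_spec_def monoid_prime_def monoid_ideal_def)
  then have "openin (zariski (half_monoid e)) (monoid_spec (half_monoid e))"
    unfolding op using whole by (intro exI[of _ "half_monoid e"]) blast
  moreover have "U \<subseteq> monoid_spec (half_monoid e)" if "openin (zariski (half_monoid e)) U" for U
    using that unfolding op by blast
  ultimately show "topspace (zariski (half_monoid e)) = {{0}, half_max e}"
    unfolding spec by (metis openin_subset openin_topspace subset_antisym)
  \<comment> \<open>The ideal \<open>half_max e\<close> is contained in itself but not in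
    \<open>{0}\<close>.\<close>
  show "openin (zariski (half_monoid e)) {{0}}"
    unfolding op spec
    using mI[of "half_max e"] half_max_ne_0[of e] max_0
    by (intro exI[of _ "half_max e"]) (auto simp: spec)
  show "\<not> openin (zariski (half_monoid e)) {half_max e}"
  proof
    assume "openin (zariski (half_monoid e)) {half_max e}"
    then obtain I where I: "{half_max e} = {{0}, half_max e} - {P \<in> {{0}, half_max e}. I \<subseteq> P}" (is "_ = ?R")
      unfolding op spec by (elim exE conjE)
    have "half_max e \<in> ?R" by (subst I[symmetric]) simp
    moreover have "{0} \<notin> ?R" by (subst I[symmetric]) (simp add: half_max_ne_0[symmetric])
    \<comment> \<open>An ideal inside \<open>{0}\<close> lies in every prime, so a closed set
      containing the generic point contains \<open>half_max e\<close> as well.\<close>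
    ultimately have "\<not> I \<subseteq> half_max e" "I \<subseteq> {0}" by simp_all
    then show False using max_0 by auto
  qed
qed

text \<open>Two Sierpinski spaces are glued along their open point \<open>g\<close>. A set of
  classes is open exactly when its traces on both halves are open, so three traces decide which
  points are closed.\<close>

lemma glued_two_arrows:
  fixes X Y :: "'a topology"
  assumes X: "topspace X = {g, x}" "openin X {g}" "\<not> openin X {x}" "x \<noteq> g"
    and Y: "topspace Y = {g, y}" "openin Y {g}" "\<not> openin Y {y}" "y \<noteq> g"
    and ij: "i z = g" "j z = g"
  shows "closed_points (glued_space X Y {z} i j) = {{(True, x)}, {(False, y)}}"
proof -
  define E where "E = ({((True, g), (False, g))} \<union> {((True, g), (False, g))}\<inverse>)\<^sup>*"
  let ?S = "sum_topology (\<lambda>b. if b then X else Y) UNIV"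
  let ?G = "quotient_space ?S E"
  have glued: "glued_space X Y {z} i j = ?G"
    by (simp add: glued_space_def E_def ij)
  \<comment> \<open>The generated equivalence identifies only the two copies of
    \<open>g\<close>.\<close>
  have E: "E = Id \<union> {((True, g), (False, g)), ((False, g), (True, g))}" (is "_ = ?F")
  proof
    show "E \<subseteq> ?F"
    proof (rule subrelI)
      fix p q assume "(p, q) \<in> E"
      then show "(p, q) \<in> ?F"
        unfolding E_def by (induction rule: rtrancl_induct) auto
    qed
    show "?F \<subseteq> E" unfolding E_def by auto
  qed
  let ?a = "(True, x)" and ?b = "(False, y)" and ?g = "{(True, g), (False, g)}"
  have cls: "E `` {?a} = {?a}" "E `` {?b} = {?b}" "E `` {(True, g)} = ?g" "E `` {(False, g)} = ?g"
    using X(4) Y(4) by (auto simp: E)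
  have top_S: "topspace ?S = {(True, g), ?a, (False, g), ?b}"
    unfolding topspace_sum_topology UNIV_bool o_def by (auto simp: X(1) Y(1))
  have quot: "topspace ?S // E = {?g, {?a}, {?b}}"
    unfolding top_S quotient_def by (simp add: cls) blast
  have open_S: "openin ?S U \<longleftrightarrow> U \<subseteq> topspace ?S \<and> openin X {u. (True, u) \<in> U} \<and> openin Y {u. (False, u) \<in> U}" for U
    unfolding openin_sum_topology topspace_sum_topology by (simp add: UNIV_bool) blast
  have open_G: "openin ?G U \<longleftrightarrow> U \<subseteq> {?g, {?a}, {?b}} \<and>
      openin X {u \<in> {g, x}. E `` {(True, u)} \<in> U} \<and> openin Y {u \<in> {g, y}. E `` {(False, u)} \<in> U}" for U
  proof -
    have "{u. (True, u) \<in> {p \<in> topspace ?S. E `` {p} \<in> U}} = {u \<in> {g, x}. E `` {(True, u)} \<in> U}"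
      "{u. (False, u) \<in> {p \<in> topspace ?S. E `` {p} \<in> U}} = {u \<in> {g, y}. E `` {(False, u)} \<in> U}"
      unfolding top_S by auto
    then show ?thesis
      unfolding openin_quotient_space quot open_S[of "{p \<in> topspace ?S. E `` {p} \<in> U}"] by auto
  qed
  have ne: "{?a} \<noteq> {?b}" "{?a} \<noteq> ?g" "{?b} \<noteq> ?g" "?g \<noteq> {?a}" "?g \<noteq> {?b}" "{?b} \<noteq> {?a}"
    using X(4) Y(4) by auto
  have opens: "openin X {g, x}" "openin Y {g, y}" "openin X {x, g}" "openin Y {y, g}"
    using openin_topspace[of X] openin_topspace[of Y] X(1) Y(1) by (simp_all add: insert_commute)
  have pair: "{u \<in> {v, w}. P u} = (if P v then {v} else {}) \<union> (if P w then {w} else {})" for P and v w :: 'a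
    by auto
  have restrict:
    "{u \<in> {g, x}. E `` {(True, u)} \<in> U} = (if ?g \<in> U then {g} else {}) \<union> (if {?a} \<in> U then {x} else {})"
    "{u \<in> {g, y}. E `` {(False, u)} \<in> U} = (if ?g \<in> U then {g} else {}) \<union> (if {?b} \<in> U then {y} else {})" for U
    unfolding pair cls by (rule refl)+
  have top_G: "topspace ?G = {?g, {?a}, {?b}}"
  proof
    show "topspace ?G \<subseteq> {?g, {?a}, {?b}}" using open_G openin_topspace by blast
    have "openin ?G {?g, {?a}, {?b}}"
      unfolding open_G restrict using opens by simp
    then show "{?g, {?a}, {?b}} \<subseteq> topspace ?G" by (rule openin_subset)
  qed
  have diff: "{?g, {?a}, {?b}} - {{?a}} = {?g, {?b}}" "{?g, {?a}, {?b}} - {{?b}} = {?g, {?a}}"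
    "{?g, {?a}, {?b}} - {?g} = {{?a}, {?b}}"
    using ne by auto
  \<comment> \<open>The complement of either point has trace \<open>{g}\<close> on its own half and
    is everything on the other half.\<close>
  have "closedin ?G {{?a}}" "closedin ?G {{?b}}"
    unfolding closedin_def top_G diff open_G restrict using ne opens X Y by auto
  \<comment> \<open>The complement of the generic class has the traces \<open>{x}\<close> and
    \<open>{y}\<close>, which are not open.\<close>
  moreover have "\<not> closedin ?G {?g}"
    unfolding closedin_def top_G diff open_G restrict using ne X Y by simp
  ultimately show ?thesis
    unfolding glued closed_points_def top_G by blast
qed

text \<open>The only prime \<open>{0}\<close> of \<open>C_inf\<close> restricts to
  \<open>{0}\<close> on both halves, so this is the common open point.\<close>

lemma closed_points_P1_F1:
  "closed_points P1_F1 = {{(True, half_max 1)}, {(False, half_max (-1))}}"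
  unfolding P1_F1_def monoid_spec_C_inf C_inf_plus_eq C_inf_minus_eq
  by (intro glued_two_arrows[where g = "{0}"] zariski_half_monoid half_max_ne_0)
    (auto simp: half_monoid_def)

text \<open>Closed points stay closed in the subspace, which is therefore T1, and a finite T1 space
  is discrete.\<close>

lemma finite_closed_points_discrete:
  assumes "finite (closed_points X)"
  shows "subtopology X (closed_points X) = discrete_topology (closed_points X)"
proof (rule finite_t1_space_imp_discrete_topology)
  show top: "topspace (subtopology X (closed_points X)) = closed_points X"
    by (auto simp: closed_points_def)
  show "t1_space (subtopology X (closed_points X))"
    unfolding t1_space_closedin_singleton top
    by (auto simp: closed_points_def intro!: closedin_subset_topspace)
qed fact

lemma homeomorphic_discrete_topologies:
  assumes "bij_betw f A B"
  shows "discrete_topology A homeomorphic_space discrete_topology B"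
proof -
  have "homeomorphic_map (discrete_topology A) (discrete_topology B) f"
    using assms
    by (intro bijective_open_imp_homeomorphic_map) (auto simp: bij_betw_def open_map_def)
  then show ?thesis by (rule homeomorphic_map_imp_homeomorphic_space)
qed

theorem theoremC:
  shows "abstract_curve homeomorphic_space subtopology P1_F1 (closed_points P1_F1)"
proof -
  obtain A B where "A \<noteq> B" and curve: "abstract_curve = discrete_topology {A, B}"
    by (rule abstract_curve_two_points)
  \<comment> \<open>Both spaces are discrete with two points, so any bijection between them is a
    homeomorphism.\<close>
  then have "bij_betw (\<lambda>Q. if Q = A then {(True, half_max 1)} else {(False, half_max (-1))})
      {A, B} (closed_points P1_F1)"
    unfolding closed_points_P1_F1 by (auto simp: bij_betw_def inj_on_def)
  moreover have "subtopology P1_F1 (closed_points P1_F1) = discrete_topology (closed_points P1_F1)"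
    by (rule finite_closed_points_discrete) (simp add: closed_points_P1_F1)
  ultimately show ?thesis
    unfolding curve by (simp add: homeomorphic_discrete_topologies)
qed

end
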